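(* Let $\mathscr D\in C^3([-1,1])$ with $\mathscr D(-1)=\mathscr D(1)=0$. Suppose that for every $N$ the nodes $\mu_n=\mu_n^N$ and points $\mu_{n+1/2}=\mu_{n+1/2}^N$ are given and that, as $N\to\infty$: (1) $-1=\mu_{1/2}<\mu_1<\mu_{1+1/2}<\cdots<\mu_{N-1/2}<\mu_N<\mu_{N+1/2}=1$ for every $N$; (2) $\widetilde M_N=O(N^{-1})$; (3) $D_N^*=O(N^{-q})$ with $q\ge 2$; (4) $D_N=O(N^{-r})$ with $r\ge 2$; (5) $1/m_N^*=O(N^{s})$ with $1\le s\le 4m-2$, where $m=\min\{q,r\}$; (6) $\beta_N(\mathscr D)=O(N^{-t})$ with $t\ge 2$. Then the type I scheme $\Delta_{{\rm FP},N}$ converges with order $2$ for every $f\in C^5([-1,1])$, i.e. $\max_{1\le n\le N}|\Delta_{\rm FP}f(\mu_n)-\Delta_{{\rm FP},N}f(\mu_n)|=O(N^{-2})$. The same conclusion holds if, instead of (1)--(6), one assumes either (i) $D_N=D_N^*=0$ for all $N$, and (1) and (2) hold; or (ii) $d_1=\cdots=d_{N-1}$ for all $N$, and (1)--(5) hold.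
   Context: For each natural $N$ one is given nodes $\mu_1,\dots,\mu_N$ and points $\mu_{1/2},\dots,\mu_{N+1/2}$ in $[-1,1]$ (dependence on $N$ suppressed). All $O(\cdot)$ are as $N\to\infty$; quantities given by maxima over empty index sets (small $N$) are irrelevant. Definitions: - $\widetilde M_N=\max\{\mu_1+1,\ \max_{1\le n\le N-1}(\mu_{n+1}-\mu_n),\ 1-\mu_N\}$. - $d_n=\frac{\mu_n+\mu_{n+1}}2-\mu_{n+1/2}$ for $1\le n\le N-1$; $D_N=\max_{1\le n\le N-1}|d_n|$. - $d_n^*=\frac{\mu_{n-1/2}+\mu_{n+1/2}}2-\mu_n$ for $1\le n\le N$; $D_N^*=\max_{1\le n\le N}|d_n^*|$. - $m_N^*=\min_{1\le n\le N}(\mu_{n+1/2}-\mu_{n-1/2})$. - $\beta_N(\mathscr D)=\max_{2\le n\le N-1}\left|\frac{(d_{n-1}-d_n)\,\mathscr D(\mu_{n+1/2})}{\mu_{n+1/2}-\mu_{n-1/2}}\right|$. The operator is $\Delta_{\rm FP}f(\mu)=(\mathscr D(\mu)f'(\mu))'$ on $[-1,1]$. The type I scheme is, for $n=1,\dots,N$, $$\Delta_{{\rm FP},N}f(\mu_n)=\frac{\mathscr D(\mu_{n+1/2})\frac{f(\mu_{n+1})-f(\mu_n)}{\mu_{n+1}-\mu_n}-\mathscr D(\mu_{n-1/2})\frac{f(\mu_n)-f(\mu_{n-1})}{\mu_n-\mu_{n-1}}}{\mu_{n+1/2}-\mu_{n-1/2}},$$ where the terms containing the undefined nodes $\mu_0$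 (when $n=1$) and $\mu_{N+1}$ (when $n=N$) are omitted (they are multiplied by $\mathscr D(\mp1)=0$). *)

theory Defs
  imports "HOL-Analysis.Analysis" "HOL-Library.Landau_Symbols"
begin

text \<open>
  Conventions: for a fixed \<open>N\<close>, the node \<open>\<mu>\<^sub>n\<close> (\<open>1 \<le> n \<le> N\<close>) is \<open>\<mu> n\<close>, and the half-index point
  \<open>\<mu>\<^bsub>n+1/2\<^esub>\<close> (\<open>0 \<le> n \<le> N\<close>) is \<open>\<nu> n\<close>, so that \<open>\<mu>\<^bsub>n-1/2\<^esub>\<close> is \<open>\<nu> (n - 1)\<close>.
  Maxima of nonnegative quantities over an index set that can be empty for small \<open>N\<close>
  are taken together with \<open>0\<close>.
\<close>

text \<open>
  \<open>C\<^sup>k\<close> on a set without isolated points; derivatives are relative to the set, hence one-sided at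
  the end points of an interval. \<open>g i\<close> is the \<open>i\<close>-th derivative.
\<close>

definition Ck_on :: "nat \<Rightarrow> (real \<Rightarrow> real) \<Rightarrow> real set \<Rightarrow> bool" where
  "Ck_on k f S \<longleftrightarrow>
     (\<exists>g. (\<forall>x\<in>S. g 0 x = f x) \<and>
          (\<forall>i<k. \<forall>x\<in>S. (g i has_real_derivative g (Suc i) x) (at x within S)) \<and>
          (\<forall>i\<le>k. continuous_on S (g i)))"

definition staggered_grid :: "nat \<Rightarrow> (nat \<Rightarrow> real) \<Rightarrow> (nat \<Rightarrow> real) \<Rightarrow> bool" where
  "staggered_grid N \<mu> \<nu> \<longleftrightarrow>
     \<nu> 0 = -1 \<and> \<nu> N = 1 \<and> (\<forall>n\<in>{1..N}. \<nu> (n - 1) < \<mu> n \<and> \<mu> n < \<nu> n)"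

definition max_gap :: "nat \<Rightarrow> (nat \<Rightarrow> real) \<Rightarrow> real" where
  "max_gap N \<mu> = Max ({\<mu> 1 + 1, 1 - \<mu> N} \<union> (\<lambda>n. \<mu> (n + 1) - \<mu> n) ` {1..<N})"

definition dev :: "(nat \<Rightarrow> real) \<Rightarrow> (nat \<Rightarrow> real) \<Rightarrow> nat \<Rightarrow> real" where
  "dev \<mu> \<nu> n = (\<mu> n + \<mu> (n + 1)) / 2 - \<nu> n"

definition dev_star :: "(nat \<Rightarrow> real) \<Rightarrow> (nat \<Rightarrow> real) \<Rightarrow> nat \<Rightarrow> real" where
  "dev_star \<mu> \<nu> n = (\<nu> (n - 1) + \<nu> n) / 2 - \<mu> n"

definition max_dev :: "nat \<Rightarrow> (nat \<Rightarrow> real) \<Rightarrow> (nat \<Rightarrow> real) \<Rightarrow> real" where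
  "max_dev N \<mu> \<nu> = Max (insert 0 ((\<lambda>n. \<bar>dev \<mu> \<nu> n\<bar>) ` {1..<N}))"

definition max_dev_star :: "nat \<Rightarrow> (nat \<Rightarrow> real) \<Rightarrow> (nat \<Rightarrow> real) \<Rightarrow> real" where
  "max_dev_star N \<mu> \<nu> = Max ((\<lambda>n. \<bar>dev_star \<mu> \<nu> n\<bar>) ` {1..N})"

definition min_gap_star :: "nat \<Rightarrow> (nat \<Rightarrow> real) \<Rightarrow> real" where
  "min_gap_star N \<nu> = Min ((\<lambda>n. \<nu> n - \<nu> (n - 1)) ` {1..N})"

definition beta ::
  "(real \<Rightarrow> real) \<Rightarrow> nat \<Rightarrow> (nat \<Rightarrow> real) \<Rightarrow> (nat \<Rightarrow> real) \<Rightarrow> real" where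
  "beta D N \<mu> \<nu> =
     Max (insert 0 ((\<lambda>n. \<bar>(dev \<mu> \<nu> (n - 1) - dev \<mu> \<nu> n) * D (\<nu> n) / (\<nu> n - \<nu> (n - 1))\<bar>) ` {2..<N}))"

definition Delta_FP :: "(real \<Rightarrow> real) \<Rightarrow> (real \<Rightarrow> real) \<Rightarrow> real \<Rightarrow> real" where
  "Delta_FP D f x =
     vector_derivative (\<lambda>y. D y * vector_derivative f (at y within {-1..1})) (at x within {-1..1})"

definition type_I_scheme ::
  "(real \<Rightarrow> real) \<Rightarrow> nat \<Rightarrow> (nat \<Rightarrow> real) \<Rightarrow> (nat \<Rightarrow> real) \<Rightarrow> (real \<Rightarrow> real) \<Rightarrow> nat \<Rightarrow> real" where
  "type_I_scheme D N \<mu> \<nu> f n =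
     ((if n = N then 0 else D (\<nu> n) * ((f (\<mu> (n + 1)) - f (\<mu> n)) / (\<mu> (n + 1) - \<mu> n)))
      - (if n = 1 then 0 else D (\<nu> (n - 1)) * ((f (\<mu> n) - f (\<mu> (n - 1))) / (\<mu> n - \<mu> (n - 1)))))
     / (\<nu> n - \<nu> (n - 1))"

definition scheme_error ::
  "(real \<Rightarrow> real) \<Rightarrow> nat \<Rightarrow> (nat \<Rightarrow> real) \<Rightarrow> (nat \<Rightarrow> real) \<Rightarrow> (real \<Rightarrow> real) \<Rightarrow> real" where
  "scheme_error D N \<mu> \<nu> f =
     Max ((\<lambda>n. \<bar>Delta_FP D f (\<mu> n) - type_I_scheme D N \<mu> \<nu> f n\<bar>) ` {1..N})"

end

theory Submission
  imports Defs
begin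

text \<open>
  Fix a node \<open>x = \<mu>\<^sub>n\<close>, its gaps \<open>a\<close>, \<open>b\<close> to the left and right neighbour, and
  \<open>w = \<mu>\<^bsub>n+1/2\<^esub> - \<mu>\<^bsub>n-1/2\<^esub>\<close>. Write the scheme as
  \<open>D\<^sub>+ (f[x,x+b] - f[x-a,x]) / w + ((D\<^sub>+ - D\<^sub>-) / w) f[x-a,x]\<close> and expand everything at \<open>x\<close>.
  Up to \<open>O(N\<^sup>-\<^sup>2)\<close> the first-order terms combine to \<open>D' f'' (p - a/2)\<close> with
  \<open>p = \<mu>\<^bsub>n+1/2\<^esub> - x\<close>, and \<open>p - a/2 = 2 d\<^sup>*\<^sub>n + d\<^bsub>n-1\<^esub>\<close>. Division by the possibly tiny \<open>w\<close> is
  harmless because \<open>a + b = 2 (w + d\<^sub>n - d\<^bsub>n-1\<^esub>)\<close>, so \<open>\<beta>\<^sub>N\<close> controls \<open>D\<^sub>+ (a + b) / w\<close>. At the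
  outermost nodes \<open>D\<close> vanishes at the adjacent end point, and the remaining flux is itself a
  difference quotient of \<open>D\<close> times one of \<open>f\<close>. In the cases (i) and (ii), \<open>\<beta>\<^sub>N = 0\<close>.
\<close>

section \<open>Taylor estimates with uniform constants\<close>

text \<open>The derivatives form an explicit family, as \<open>field_Taylor\<close> takes them, and
  one constant bounds all orders up to \<open>k\<close>, so that later estimates carry a single
  \<open>K\<close>.\<close>

definition bounded_derivs :: "nat \<Rightarrow> (nat \<Rightarrow> real \<Rightarrow> real) \<Rightarrow> real \<Rightarrow> real set \<Rightarrow> bool" where
  "bounded_derivs k g K S \<longleftrightarrow>
     (\<forall>i<k. \<forall>x\<in>S. (g i has_real_derivative g (Suc i) x) (at x within S)) \<and>
     (\<forall>i\<le>k. \<forall>x\<in>S. \<bar>g i x\<bar> \<le> K)"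

lemma bounded_derivsD:
  assumes "bounded_derivs k g K S" "x \<in> S"
  shows "i < k \<Longrightarrow> (g i has_real_derivative g (Suc i) x) (at x within S)"
    and "i \<le> k \<Longrightarrow> \<bar>g i x\<bar> \<le> K"
  using assms unfolding bounded_derivs_def by auto

lemma bounded_derivs_mono:
  assumes "bounded_derivs k g K S" "K \<le> K'"
  shows "bounded_derivs k g K' S"
  using assms unfolding bounded_derivs_def by (meson order_trans)

text \<open>Each continuous derivative is bounded on the compact set; the sum of the finitely many
  bounds dominates each of them.\<close>

lemma Ck_on_bounded_derivs:
  assumes "Ck_on k f S" "compact S"
  obtains g K where "\<And>x. x \<in> S \<Longrightarrow> f x = g 0 x" "bounded_derivs k g K S"
proof -
  obtain g where g: "\<forall>x\<in>S. g 0 x = f x"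
    "\<forall>i<k. \<forall>x\<in>S. (g i has_real_derivative g (Suc i) x) (at x within S)"
    "\<forall>i\<le>k. continuous_on S (g i)"
    using assms(1) unfolding Ck_on_def by blast
  have "\<exists>B. \<forall>x\<in>S. \<bar>g i x\<bar> \<le> B" if "i \<le> k" for i
    using compact_imp_bounded[OF compact_continuous_image[OF _ assms(2)], of "g i"] g(3) that
    by (auto simp: bounded_iff)
  then obtain B where B: "\<And>i x. i \<le> k \<Longrightarrow> x \<in> S \<Longrightarrow> \<bar>g i x\<bar> \<le> B i" by metis
  have "\<bar>g i x\<bar> \<le> (\<Sum>j\<le>k. \<bar>B j\<bar>)" if "i \<le> k" "x \<in> S" for i x
  proof -
    have "\<bar>g i x\<bar> \<le> \<bar>B i\<bar>" using B[OF that] by linarith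
    also have "\<dots> \<le> (\<Sum>j\<le>k. \<bar>B j\<bar>)"
      by (rule member_le_sum) (use that in auto)
    finally show ?thesis .
  qed
  then show thesis using that[of g "\<Sum>j\<le>k. \<bar>B j\<bar>"] g unfolding bounded_derivs_def by auto
qed

text \<open>This is \<open>field_Taylor\<close> with the factor \<open>1 / fact n\<close> dropped.
  Order \<open>n\<close> uses the bounded derivative of order \<open>n + 1\<close>, hence
  \<open>n < k\<close>.\<close>

lemma bounded_derivs_Taylor:
  assumes "bounded_derivs k g K S" "convex S" "n < k" "x \<in> S" "z \<in> S"
  shows "\<bar>g 0 z - (\<Sum>i\<le>n. g i x * (z - x) ^ i / fact i)\<bar> \<le> K * \<bar>z - x\<bar> ^ Suc n"
proof -
  have K: "0 \<le> K" using bounded_derivsD(2)[OF assms(1,4), of 0] by auto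
  have "\<bar>g 0 z - (\<Sum>i\<le>n. g i x * (z - x) ^ i / fact i)\<bar> \<le> K * \<bar>z - x\<bar> ^ Suc n / fact n"
    using field_Taylor[of S n g K x z] assms bounded_derivsD[OF assms(1)]
    by auto
  also have "\<dots> \<le> K * \<bar>z - x\<bar> ^ Suc n / 1"
    by (rule divide_left_mono) (use K fact_ge_1[of n, where 'a=real] in auto)
  finally show ?thesis by simp
qed

text \<open>Dividing Taylor's formula by the step costs one power of \<open>e\<close>. The sign of
  \<open>e\<close> is free, so left and right quotients are both covered.\<close>

lemma difference_quotient_bounds:
  assumes "bounded_derivs k g K S" "convex S" "4 \<le> k" "x \<in> S" "x + e \<in> S" "e \<noteq> 0"
  defines "Q \<equiv> (g 0 (x + e) - g 0 x) / e"
  shows "\<bar>Q\<bar> \<le> K"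
    and "\<bar>Q - (g 1 x + g 2 x * e / 2)\<bar> \<le> K * e\<^sup>2"
    and "\<bar>Q - (g 1 x + g 2 x * e / 2 + g 3 x * e\<^sup>2 / 6)\<bar> \<le> K * \<bar>e\<bar> ^ 3"
proof -
  have *: "\<bar>Q - A\<bar> \<le> K * \<bar>e\<bar> ^ j"
    if "\<bar>g 0 (x + e) - (g 0 x + A * e)\<bar> \<le> K * \<bar>e\<bar> ^ Suc j" for A j
  proof -
    have "\<bar>Q - A\<bar> = \<bar>g 0 (x + e) - (g 0 x + A * e)\<bar> / \<bar>e\<bar>"
      using assms(6) unfolding Q_def abs_divide[symmetric] by (simp add: field_simps)
    also have "\<dots> \<le> K * \<bar>e\<bar> ^ Suc j / \<bar>e\<bar>"
      by (rule divide_right_mono[OF that]) auto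
    finally show ?thesis using assms(6) by simp
  qed
  note T = bounded_derivs_Taylor[OF assms(1,2) _ assms(4,5)]
  show "\<bar>Q\<bar> \<le> K"
    using *[of 0 0] T[of 0] assms(3) by simp
  have "\<bar>Q - (g 1 x + g 2 x * e / 2)\<bar> \<le> K * \<bar>e\<bar> ^ 2"
    by (rule *) (use T[of 2] assms(3) in \<open>simp add: eval_nat_numeral algebra_simps\<close>)
  then show "\<bar>Q - (g 1 x + g 2 x * e / 2)\<bar> \<le> K * e\<^sup>2" by simp
  show "\<bar>Q - (g 1 x + g 2 x * e / 2 + g 3 x * e\<^sup>2 / 6)\<bar> \<le> K * \<bar>e\<bar> ^ 3"
    by (rule *) (use T[of 3] assms(3) in \<open>simp add: eval_nat_numeral algebra_simps fact_numeral\<close>)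
qed

text \<open>Only two factors of \<open>e\<close> are traded for \<epsilon>. The third one is kept to
  cancel a denominator such as \<open>p + m\<close> or \<open>a + b\<close>, which has no lower
  bound.\<close>

lemma cube_le:
  fixes e h \<epsilon> :: real
  assumes "0 < e" "e \<le> h" "h\<^sup>2 \<le> \<epsilon>"
  shows "e\<^sup>2 \<le> \<epsilon>" "e ^ 3 \<le> \<epsilon> * e"
proof -
  have "e\<^sup>2 \<le> h\<^sup>2" using assms by (intro power_mono) auto
  then show *: "e\<^sup>2 \<le> \<epsilon>" using assms(3) by linarith
  have "e\<^sup>2 * e \<le> \<epsilon> * e" using assms(1) * by (intro mult_right_mono) auto
  then show "e ^ 3 \<le> \<epsilon> * e" by (simp add: eval_nat_numeral algebra_simps)
qed

text \<open>The quadratic Taylor terms leave \<open>g 2 x * (p - m) / 2\<close>, where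
  \<open>(p - m) / 2\<close> is the deviation of the midpoint from \<open>x\<close>. The cubic
  remainders are at most \<open>K * \<epsilon> * (p + m)\<close>, so dividing by a tiny
  \<open>p + m\<close> is harmless.\<close>

lemma staggered_quotient_bound:
  assumes "bounded_derivs k g K S" "convex S" "3 \<le> k" "x \<in> S" "x + p \<in> S" "x - m \<in> S"
    and "0 < p" "0 < m" "p \<le> h" "m \<le> h" "h\<^sup>2 \<le> \<epsilon>" "\<bar>p - m\<bar> \<le> 2 * \<epsilon>"
  shows "\<bar>(g 0 (x + p) - g 0 (x - m)) / (p + m) - g 1 x\<bar> \<le> 2 * K * \<epsilon>"
proof -
  have K: "\<bar>g 2 x\<bar> \<le> K" using bounded_derivsD(2)[OF assms(1,4), of 2] assms(3) by auto
  then have K0: "0 \<le> K" by linarith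
  define U where "U = g 0 (x + p) - (g 0 x + g 1 x * p + g 2 x * p\<^sup>2 / 2)"
  define V where "V = g 0 (x - m) - (g 0 x - g 1 x * m + g 2 x * m\<^sup>2 / 2)"
  have U: "\<bar>U\<bar> \<le> K * p ^ 3"
    using bounded_derivs_Taylor[OF assms(1,2) _ assms(4,5), of 2] assms(3,7)
    unfolding U_def by (simp add: eval_nat_numeral algebra_simps)
  have V: "\<bar>V\<bar> \<le> K * m ^ 3"
    using bounded_derivs_Taylor[OF assms(1,2) _ assms(4,6), of 2] assms(3,8)
    unfolding V_def by (simp add: eval_nat_numeral algebra_simps)
  have "p ^ 3 + m ^ 3 \<le> \<epsilon> * (p + m)"
    using cube_le(2)[OF assms(7,9,11)] cube_le(2)[OF assms(8,10,11)] by (simp add: algebra_simps)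
  then have "K * (p ^ 3 + m ^ 3) \<le> K * (\<epsilon> * (p + m))" using K0 by (rule mult_left_mono)
  then have UV: "\<bar>U - V\<bar> \<le> K * \<epsilon> * (p + m)" using U V by (simp add: algebra_simps)
  have "(g 0 (x + p) - g 0 (x - m)) / (p + m) - g 1 x = g 2 x * (p - m) / 2 + (U - V) / (p + m)"
    using assms(7,8) unfolding U_def V_def by (simp add: field_simps power2_eq_square)
  moreover have "\<bar>(U - V) / (p + m)\<bar> \<le> K * \<epsilon>"
    using UV assms(7,8) by (simp add: abs_divide pos_divide_le_eq)
  moreover have "\<bar>g 2 x * (p - m)\<bar> \<le> K * (2 * \<epsilon>)"
    unfolding abs_mult using K assms(12) K0 by (intro mult_mono) auto
  ultimately show ?thesis by linarith
qed

section \<open>Error algebra at a single node\<close>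

lemma abs_mult_le:
  fixes x y :: real
  assumes "\<bar>x\<bar> \<le> a" "\<bar>y\<bar> \<le> b" shows "\<bar>x * y\<bar> \<le> a * b"
  unfolding abs_mult by (intro mult_mono) (use assms in auto)

text \<open>
  \<open>Q\<close> is the one-sided difference quotient with step \<open>e\<close>, \<open>L\<close> the difference quotient of \<open>D\<close>,
  and \<open>D\<close> vanishes at distance \<open>c\<close> from the node.
\<close>

lemma boundary_error_algebra:
  fixes K :: real
  assumes "1 \<le> K" "\<bar>D1\<bar> \<le> K" "\<bar>\<phi>1\<bar> \<le> K" "\<bar>Q\<bar> \<le> K"
    and "\<bar>L - D1\<bar> \<le> 2 * K * \<epsilon>" "\<bar>Q - (\<phi> + \<phi>1 * e / 2)\<bar> \<le> K * \<epsilon>" "\<bar>D0 - D1 * c\<bar> \<le> K * \<epsilon>"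
    and "\<bar>e / 2 - c\<bar> \<le> 3 * \<epsilon>"
  shows "\<bar>D1 * \<phi> + D0 * \<phi>1 - L * Q\<bar> \<le> 7 * K\<^sup>2 * \<epsilon>"
proof -
  \<comment> \<open>Every summand has one small factor: the first-order parts of \<open>Q\<close>
    and \<open>D0\<close> cancel up to \<open>e / 2 - c\<close>. The constants add up to 2 + 1 + 1 +
    3 = 7.\<close>
  have "D1 * \<phi> + D0 * \<phi>1 - L * Q =
      - ((L - D1) * Q) - D1 * (Q - (\<phi> + \<phi>1 * e / 2)) + \<phi>1 * (D0 - D1 * c)
      - D1 * \<phi>1 * (e / 2 - c)"
    by (simp add: algebra_simps)
  moreover have "\<bar>(L - D1) * Q\<bar> \<le> 2 * K * \<epsilon> * K" by (intro abs_mult_le assms)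
  moreover have "\<bar>D1 * (Q - (\<phi> + \<phi>1 * e / 2))\<bar> \<le> K * (K * \<epsilon>)"
    by (intro abs_mult_le assms)
  moreover have "\<bar>\<phi>1 * (D0 - D1 * c)\<bar> \<le> K * (K * \<epsilon>)"
    by (intro abs_mult_le assms)
  moreover have "\<bar>D1 * \<phi>1 * (e / 2 - c)\<bar> \<le> K * K * (3 * \<epsilon>)"
    by (intro abs_mult_le assms)
  ultimately have "\<bar>D1 * \<phi> + D0 * \<phi>1 - L * Q\<bar> \<le>
      2 * K * \<epsilon> * K + K * (K * \<epsilon>) + K * (K * \<epsilon>) + K * K * (3 * \<epsilon>)" by linarith
  then show ?thesis by (simp add: power2_eq_square algebra_simps)
qed

text \<open>
  \<open>P\<close>, \<open>Q\<close> are the right and left difference quotients and \<open>\<delta> = d\<^sub>n - d\<^bsub>n-1\<^esub>\<close>; third-order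
  remainders survive division by \<open>w\<close> because \<open>(a + b) Dp / w\<close> is bounded.
\<close>

lemma interior_error_algebra:
  fixes K :: real
  assumes "1 \<le> K" "\<bar>D1\<bar> \<le> K" "\<bar>Dp\<bar> \<le> K" "\<bar>\<phi>1\<bar> \<le> K" "\<bar>\<phi>2\<bar> \<le> K" "\<bar>Q\<bar> \<le> K"
    and "0 < a" "0 < b" "a \<le> h" "b \<le> h" "h\<^sup>2 \<le> \<epsilon>" "\<epsilon> \<le> 1" "0 < w"
    and "\<bar>(Dp - Dm) / w - D1\<bar> \<le> 2 * K * \<epsilon>"
    and "\<bar>Q - (\<phi> - \<phi>1 * a / 2)\<bar> \<le> K * \<epsilon>"
    and "\<bar>Q - (\<phi> - \<phi>1 * a / 2 + \<phi>2 * a\<^sup>2 / 6)\<bar> \<le> K * a ^ 3"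
    and "\<bar>P - (\<phi> + \<phi>1 * b / 2 + \<phi>2 * b\<^sup>2 / 6)\<bar> \<le> K * b ^ 3"
    and "\<bar>Dp - (D0 + D1 * p)\<bar> \<le> K * \<epsilon>" "\<bar>p - a / 2\<bar> \<le> 3 * \<epsilon>" "\<bar>b - a\<bar> \<le> 8 * \<epsilon>"
    and "a + b = 2 * (w + \<delta>)" "\<bar>\<delta> * Dp / w\<bar> \<le> \<epsilon>"
  shows "\<bar>D1 * \<phi> + D0 * \<phi>1 - (Dp * P - Dm * Q) / w\<bar> \<le> 20 * K\<^sup>2 * \<epsilon>"
proof -
  have \<epsilon>: "0 \<le> \<epsilon>" using assms(11) zero_le_power2[of h] by linarith
  define B where "B = \<delta> * Dp / w"
  have B: "\<bar>B\<bar> \<le> \<epsilon>" unfolding B_def by (rule assms(22))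
  define R where "R = ((P - (\<phi> + \<phi>1 * b / 2 + \<phi>2 * b\<^sup>2 / 6)) -
     (Q - (\<phi> - \<phi>1 * a / 2 + \<phi>2 * a\<^sup>2 / 6))) / (a + b)"
  \<comment> \<open>\<open>Z\<close> is what \<open>(P - Q) / (a + b)\<close> contains besides
    \<open>\<phi>1 / 2\<close>: the quadratic terms contribute \<open>b\<^sup>2 - a\<^sup>2\<close>,
    from which \<open>a + b\<close> cancels.\<close>
  define Z where "Z = \<phi>2 * (b - a) / 6 + R"
  have "a ^ 3 + b ^ 3 \<le> \<epsilon> * (a + b)"
    using cube_le(2)[OF assms(7,9,11)] cube_le(2)[OF assms(8,10,11)] by (simp add: algebra_simps)
  then have "K * (a ^ 3 + b ^ 3) \<le> K * (\<epsilon> * (a + b))" using assms(1) by (intro mult_left_mono) auto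
  then have "\<bar>R\<bar> \<le> K * \<epsilon>"
    using assms(7,8,16,17) unfolding R_def by (simp add: abs_divide pos_divide_le_eq algebra_simps)
  moreover have "\<bar>\<phi>2 * (b - a)\<bar> \<le> K * (8 * \<epsilon>)" by (intro abs_mult_le assms)
  ultimately have Z: "\<bar>Z\<bar> \<le> 3 * K * \<epsilon>" using assms(1) \<epsilon> mult_nonneg_nonneg[of K \<epsilon>]
    unfolding Z_def by linarith
  have "P - Q = (a + b) * (\<phi>1 / 2 + Z)"
    using assms(7,8) unfolding Z_def R_def by (simp add: field_simps power2_eq_square)
  \<comment> \<open>The division by \<open>w\<close> is absorbed here: the part \<open>2 * w\<close>
    of \<open>a + b\<close> cancels it, and the rest is the bounded quantity
    \<open>B\<close>.\<close>
  moreover have "Dp * (a + b) / w = 2 * Dp + 2 * B"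
    using assms(13) unfolding assms(21) B_def by (simp add: field_simps)
  moreover have "Dp * ((a + b) * (\<phi>1 / 2 + Z)) / w = Dp * (a + b) / w * (\<phi>1 / 2 + Z)" by simp
  ultimately have PQ: "Dp * (P - Q) / w = (2 * Dp + 2 * B) * (\<phi>1 / 2 + Z)" by metis
  have "(Dp * P - Dm * Q) / w = Dp * (P - Q) / w + (Dp - Dm) / w * Q"
    using assms(13) by (simp add: field_simps)
  \<comment> \<open>The leading part \<open>Dp * \<phi>1\<close> of the first term meets
    \<open>D0 * \<phi>1\<close>; the first-order parts of \<open>Dp\<close> and \<open>Q\<close>
    then combine to \<open>p - a / 2\<close>. The bounds below add up to 2 + 1 + 1 + 3 + 1 + 12 =
    20.\<close>
  then have "D1 * \<phi> + D0 * \<phi>1 - (Dp * P - Dm * Q) / w =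
     - (((Dp - Dm) / w - D1) * Q) - D1 * (Q - (\<phi> - \<phi>1 * a / 2)) - \<phi>1 * (Dp - (D0 + D1 * p))
     - D1 * \<phi>1 * (p - a / 2) - B * \<phi>1 - 2 * ((Dp + B) * Z)"
    unfolding PQ by (simp add: algebra_simps)
  moreover have "\<bar>((Dp - Dm) / w - D1) * Q\<bar> \<le> 2 * K * \<epsilon> * K"
    by (intro abs_mult_le assms)
  moreover have "\<bar>D1 * (Q - (\<phi> - \<phi>1 * a / 2))\<bar> \<le> K * (K * \<epsilon>)"
    by (intro abs_mult_le assms)
  moreover have "\<bar>\<phi>1 * (Dp - (D0 + D1 * p))\<bar> \<le> K * (K * \<epsilon>)"
    by (intro abs_mult_le assms)
  moreover have "\<bar>D1 * \<phi>1 * (p - a / 2)\<bar> \<le> K * K * (3 * \<epsilon>)"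
    by (intro abs_mult_le assms)
  moreover have "\<bar>B * \<phi>1\<bar> \<le> (K * \<epsilon>) * K"
  proof (rule abs_mult_le)
    show "\<bar>B\<bar> \<le> K * \<epsilon>" using B mult_right_mono[OF assms(1) \<epsilon>] by linarith
  qed fact
  moreover have "\<bar>(Dp + B) * Z\<bar> \<le> (2 * K) * (3 * K * \<epsilon>)"
  proof (rule abs_mult_le[OF _ Z])
    \<comment> \<open>Here \<open>\<epsilon> \<le> 1 \<le> K\<close> enters.\<close>
    show "\<bar>Dp + B\<bar> \<le> 2 * K" using B assms(1,3,12) by linarith
  qed
  ultimately have "\<bar>D1 * \<phi> + D0 * \<phi>1 - (Dp * P - Dm * Q) / w\<bar> \<le>
      2 * K * \<epsilon> * K + K * (K * \<epsilon>) + K * (K * \<epsilon>) + K * K * (3 * \<epsilon>) + (K * \<epsilon>) * K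
      + 2 * ((2 * K) * (3 * K * \<epsilon>))" by linarith
  then show ?thesis by (simp add: power2_eq_square algebra_simps)
qed

section \<open>The continuous operator and the grid quantities\<close>

text \<open>This is the product rule. The inner derivative has to be identified on the whole
  interval before the outer one can be taken at \<open>x\<close>.\<close>

lemma Delta_FP_eq:
  assumes "x \<in> {-1..1}"
    and "\<And>y. y \<in> {-1..1} \<Longrightarrow> (f has_real_derivative f1 y) (at y within {-1..1})"
    and "(f1 has_real_derivative f2) (at x within {-1..1})"
    and "(D has_real_derivative D1) (at x within {-1..1})"
  shows "Delta_FP D f x = D1 * f1 x + D x * f2"
proof -
  have f1: "vector_derivative f (at y within {-1..1}) = f1 y" if "y \<in> {-1..1}" for y
    using vector_derivative_within_cbox[of "-1" 1 y f "f1 y"] assms(2)[OF that] that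
    by (simp add: has_real_derivative_iff_has_vector_derivative)
  have "((\<lambda>y. D y * f1 y) has_real_derivative D1 * f1 x + D x * f2) (at x within {-1..1})"
    using DERIV_mult[OF assms(4,3)] by (simp add: algebra_simps)
  then have "((\<lambda>y. D y * vector_derivative f (at y within {-1..1})) has_real_derivative
      D1 * f1 x + D x * f2) (at x within {-1..1})"
    by (rule has_field_derivative_transform_within[of _ _ _ _ 1]) (use assms(1) f1 in auto)
  then show ?thesis
    unfolding Delta_FP_def
    using vector_derivative_within_cbox[of "-1" 1 x] assms(1)
    by (simp add: has_real_derivative_iff_has_vector_derivative)
qed

lemma staggered_grid_strict:
  assumes "staggered_grid N \<mu> \<nu>" "1 \<le> n" "n \<le> N"
  shows "\<nu> (n - 1) < \<mu> n" "\<mu> n < \<nu> n"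
  using assms unfolding staggered_grid_def by auto

text \<open>The half-index points increase, since a node separates consecutive ones; induction
  upwards from \<open>\<nu> 0 = -1\<close> and downwards from \<open>\<nu> N = 1\<close> confines
  them, and with them the nodes.\<close>

lemma staggered_grid_range:
  assumes "staggered_grid N \<mu> \<nu>"
  shows "n \<le> N \<Longrightarrow> \<nu> n \<in> {-1..1}" "1 \<le> n \<Longrightarrow> n \<le> N \<Longrightarrow> \<mu> n \<in> {-1..1}"
proof -
  have step: "\<nu> n \<le> \<nu> (Suc n)" if "Suc n \<le> N" for n
    using staggered_grid_strict[OF assms, of "Suc n"] that by simp
  have lower: "-1 \<le> \<nu> n" if "n \<le> N" for n
    using that
  proof (induction n)
    case 0 then show ?case using assms unfolding staggered_grid_def by simp
  next
    case (Suc n) then show ?case using step[of n] by simp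
  qed
  have upper: "\<nu> n \<le> 1" if "n \<le> N" for n
    using that
  proof (induction rule: inc_induct)
    case base then show ?case using assms unfolding staggered_grid_def by simp
  next
    case (step n) then show ?case using \<open>\<And>n. Suc n \<le> N \<Longrightarrow> \<nu> n \<le> \<nu> (Suc n)\<close>[of n] by simp
  qed
  show "n \<le> N \<Longrightarrow> \<nu> n \<in> {-1..1}" using lower upper by simp
  show "1 \<le> n \<Longrightarrow> n \<le> N \<Longrightarrow> \<mu> n \<in> {-1..1}"
    using staggered_grid_strict[OF assms, of n] lower[of "n - 1"] upper[of n] by fastforce
qed

lemma max_gap_ge:
  "\<mu> 1 + 1 \<le> max_gap N \<mu>" "1 - \<mu> N \<le> max_gap N \<mu>"
  "1 \<le> n \<Longrightarrow> n < N \<Longrightarrow> \<mu> (n + 1) - \<mu> n \<le> max_gap N \<mu>"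
  unfolding max_gap_def by (rule Max_ge; simp)+

lemma max_dev_ge: "1 \<le> n \<Longrightarrow> n < N \<Longrightarrow> \<bar>dev \<mu> \<nu> n\<bar> \<le> max_dev N \<mu> \<nu>"
  unfolding max_dev_def by (rule Max_ge) auto

lemma max_dev_star_ge: "1 \<le> n \<Longrightarrow> n \<le> N \<Longrightarrow> \<bar>dev_star \<mu> \<nu> n\<bar> \<le> max_dev_star N \<mu> \<nu>"
  unfolding max_dev_star_def by (rule Max_ge) auto

lemma beta_ge:
  "2 \<le> n \<Longrightarrow> n < N \<Longrightarrow>
    \<bar>(dev \<mu> \<nu> (n - 1) - dev \<mu> \<nu> n) * D (\<nu> n) / (\<nu> n - \<nu> (n - 1))\<bar> \<le> beta D N \<mu> \<nu>"
  unfolding beta_def by (rule Max_ge) auto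

text \<open>All numerators vanish, and the inserted \<open>0\<close> settles an empty index range.
  This supplies the bound on \<open>beta\<close> in the cases (i) and (ii).\<close>

lemma beta_eq_0:
  assumes "\<forall>n\<in>{1..<N}. dev \<mu> \<nu> n = c"
  shows "beta D N \<mu> \<nu> = 0"
proof -
  have "dev \<mu> \<nu> (n - 1) = dev \<mu> \<nu> n" if "n \<in> {2..<N}" for n
  proof -
    have "n - 1 \<in> {1..<N}" "n \<in> {1..<N}" using that by auto
    then show ?thesis using assms by metis
  qed
  then have "insert 0 ((\<lambda>n. \<bar>(dev \<mu> \<nu> (n - 1) - dev \<mu> \<nu> n) * D (\<nu> n) / (\<nu> n - \<nu> (n - 1))\<bar>) ` {2..<N}) = {0}"
    by force
  then show ?thesis unfolding beta_def by (simp only: Max_singleton)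
qed

section \<open>The error at each node of a fixed grid\<close>

text \<open>One \<epsilon> dominates all grid quantities, and the node is first, last or interior.
  With \<open>2 \<le> N\<close> the first and the last node differ, so each of them has a
  neighbour.\<close>

lemma pointwise_error_bound:
  assumes grid: "staggered_grid N \<mu> \<nu>" and N: "2 \<le> N" and n: "1 \<le> n" "n \<le> N"
    and E: "bounded_derivs 3 E K {-1..1}" and g: "bounded_derivs 4 g K {-1..1}" and K: "1 \<le> K"
    and D: "\<And>x. x \<in> {-1..1} \<Longrightarrow> D x = E 0 x" "D (-1) = 0" "D 1 = 0"
    and f: "\<And>x. x \<in> {-1..1} \<Longrightarrow> f x = g 0 x"
    and eps: "(max_gap N \<mu>)\<^sup>2 \<le> \<epsilon>" "max_dev N \<mu> \<nu> \<le> \<epsilon>" "max_dev_star N \<mu> \<nu> \<le> \<epsilon>"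
      "beta D N \<mu> \<nu> \<le> \<epsilon>" "\<epsilon> \<le> 1"
  shows "\<bar>Delta_FP D f (\<mu> n) - type_I_scheme D N \<mu> \<nu> f n\<bar> \<le> 20 * K\<^sup>2 * \<epsilon>"
proof -
  let ?S = "{-1..1::real}"
  define h where "h = max_gap N \<mu>"
  define x where "x = \<mu> n"
  define p where "p = \<nu> n - x"
  define m where "m = x - \<nu> (n - 1)"
  have h: "h\<^sup>2 \<le> \<epsilon>" using eps(1) by (simp add: h_def)
  have \<epsilon>: "0 \<le> \<epsilon>" using h zero_le_power2[of h] by linarith
  have K2: "K\<^sup>2 * \<epsilon> \<ge> 0" using \<epsilon> by simp
  note strict = staggered_grid_strict[OF grid]
  note range = staggered_grid_range[OF grid]
  have S: "x \<in> ?S" "x + p \<in> ?S" "x - m \<in> ?S"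
    using range(2)[OF n] range(1)[of n] range(1)[of "n - 1"] n unfolding x_def p_def m_def by simp_all
  have pos: "0 < p" "0 < m" using strict[OF n] unfolding x_def p_def m_def by auto
  have \<nu>0: "\<nu> 0 = -1" and \<nu>N: "\<nu> N = 1" using grid unfolding staggered_grid_def by auto
  have ph: "p \<le> h"
  proof (cases "n = N")
    case True then show ?thesis using max_gap_ge(2)[of \<mu> N] \<nu>N
      unfolding p_def x_def h_def by simp
  next
    case False
    then show ?thesis using max_gap_ge(3)[of n N \<mu>] strict(1)[of "n + 1"] n
      unfolding p_def x_def h_def by simp
  qed
  have mh: "m \<le> h"
  proof (cases "n = 1")
    case True then show ?thesis using max_gap_ge(1)[of \<mu> N] \<nu>0
      unfolding m_def x_def h_def by simp
  next
    case False
    then have "1 \<le> n - 1" "n - 1 < N" "n - 1 + 1 = n" using n by auto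
    then show ?thesis using max_gap_ge(3)[of "n - 1" N \<mu>] strict(2)[of "n - 1"]
      unfolding m_def x_def h_def by simp
  qed
  \<comment> \<open>\<open>p - m\<close> is twice \<open>dev_star \<mu> \<nu> n\<close>.\<close>
  have pm: "\<bar>p - m\<bar> \<le> 2 * \<epsilon>"
    using order_trans[OF max_dev_star_ge[OF n] eps(3)] unfolding dev_star_def p_def m_def x_def
    by (simp add: abs_le_iff field_simps)
  have convex: "convex ?S" by simp
  have L: "\<bar>(D (\<nu> n) - D (\<nu> (n - 1))) / (\<nu> n - \<nu> (n - 1)) - E 1 x\<bar> \<le> 2 * K * \<epsilon>"
    using staggered_quotient_bound[OF E convex order.refl S pos ph mh h pm] D(1)[OF S(2)] D(1)[OF S(3)]
    unfolding p_def m_def by simp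
  have Dl: "\<bar>D (x + e) - (D x + E 1 x * e)\<bar> \<le> K * \<epsilon>" if "x + e \<in> ?S" "0 < \<bar>e\<bar>" "\<bar>e\<bar> \<le> h" for e
  proof -
    have "\<bar>D (x + e) - (D x + E 1 x * e)\<bar> \<le> K * \<bar>e\<bar>\<^sup>2"
      using bounded_derivs_Taylor[OF E convex _ S(1) that(1), of 1] D(1)[OF S(1)] D(1)[OF that(1)]
      by (simp add: eval_nat_numeral algebra_simps)
    also have "\<dots> \<le> K * \<epsilon>" using cube_le(1)[OF that(2,3) h] K by (intro mult_left_mono) auto
    finally show ?thesis .
  qed
  have FP: "Delta_FP D f x = E 1 x * g 1 x + D x * g 2 x"
  proof (rule Delta_FP_eq[OF S(1)])
    show "(f has_real_derivative g 1 y) (at y within ?S)" if "y \<in> ?S" for y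
      using bounded_derivsD(1)[OF g that, of 0] that f
      by (auto intro: has_field_derivative_transform_within[of _ _ _ _ 1])
    show "(g 1 has_real_derivative g 2 x) (at x within ?S)"
      using bounded_derivsD(1)[OF g S(1), of 1] by (simp add: numeral_2_eq_2)
    show "(D has_real_derivative E 1 x) (at x within ?S)"
      using bounded_derivsD(1)[OF E S(1), of 0] S(1) D(1)
      by (auto intro: has_field_derivative_transform_within[of _ _ _ _ 1])
  qed
  have bounds: "\<bar>E 1 x\<bar> \<le> K" "\<bar>g 2 x\<bar> \<le> K" "\<bar>g 3 x\<bar> \<le> K"
    using bounded_derivsD(2)[OF E S(1)] bounded_derivsD(2)[OF g S(1)] by auto
  \<comment> \<open>The step is signed: \<open>Q b\<close> is the right quotient and
    \<open>Q (- a)\<close> the left one.\<close>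
  define Q where "Q e = (f (x + e) - f x) / e" for e
  have Q: "\<bar>Q e\<bar> \<le> K" "\<bar>Q e - (g 1 x + g 2 x * e / 2)\<bar> \<le> K * \<epsilon>"
    "\<bar>Q e - (g 1 x + g 2 x * e / 2 + g 3 x * e\<^sup>2 / 6)\<bar> \<le> K * \<bar>e\<bar> ^ 3"
    if "x + e \<in> ?S" "0 < \<bar>e\<bar>" "\<bar>e\<bar> \<le> h" for e
  proof -
    have e0: "e \<noteq> 0" using that by simp
    note q = difference_quotient_bounds[OF g convex order.refl S(1) that(1) e0,
      folded f[OF S(1)] f[OF that(1)], folded Q_def]
    show "\<bar>Q e\<bar> \<le> K" by (rule q)
    have "K * e\<^sup>2 \<le> K * \<epsilon>" using cube_le(1)[OF that(2,3) h] K by (intro mult_left_mono) auto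
    then show "\<bar>Q e - (g 1 x + g 2 x * e / 2)\<bar> \<le> K * \<epsilon>" using q(2) by linarith
    show "\<bar>Q e - (g 1 x + g 2 x * e / 2 + g 3 x * e\<^sup>2 / 6)\<bar> \<le> K * \<bar>e\<bar> ^ 3" by (rule q)
  qed
  have Q_minus: "Q (- a) = (f x - f (x - a)) / a" for a
    unfolding Q_def by (metis minus_diff_eq minus_divide_divide uminus_add_conv_diff add.commute)
  \<comment> \<open>Both outermost nodes are treated at once by signed distances:
    \<open>x - c\<close> is the adjacent end point and \<open>x + e\<close> the only
    neighbour.\<close>
  have boundary: ?thesis
    if "type_I_scheme D N \<mu> \<nu> f n = (D (\<nu> n) - D (\<nu> (n - 1))) / (\<nu> n - \<nu> (n - 1)) * Q e"
      "x + e \<in> ?S" "0 < \<bar>e\<bar>" "\<bar>e\<bar> \<le> h"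
      "D (x - c) = 0" "x - c \<in> ?S" "0 < \<bar>c\<bar>" "\<bar>c\<bar> \<le> h" "\<bar>e / 2 - c\<bar> \<le> 3 * \<epsilon>" for e c
  proof -
    have "\<bar>E 1 x * g 1 x + D x * g 2 x - (D (\<nu> n) - D (\<nu> (n - 1))) / (\<nu> n - \<nu> (n - 1)) * Q e\<bar>
      \<le> 7 * K\<^sup>2 * \<epsilon>"
    proof (rule boundary_error_algebra[OF K bounds(1,2) _ L _ _ that(9)])
      show "\<bar>D x - E 1 x * c\<bar> \<le> K * \<epsilon>" using Dl[of "- c"] that by simp
    qed (use Q[OF that(2-4)] in auto)
    then show ?thesis using K2 unfolding that(1) x_def[symmetric] FP by linarith
  qed
  \<comment> \<open>Half the gap differs from the distance to the half-index point by exactly the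
    deviation there; \<open>left\<close> is the mirror image.\<close>
  have right: "x + b = \<mu> (n + 1) \<and> x + b \<in> ?S \<and> p < b \<and> b \<le> h \<and> b / 2 = p + dev \<mu> \<nu> n \<and>
      \<bar>dev \<mu> \<nu> n\<bar> \<le> \<epsilon>"
    if "n < N" "b = \<mu> (n + 1) - x" for b
    using that range(2)[of "n + 1"] max_gap_ge(3)[of n N \<mu>] strict(1)[of "n + 1"] n
      order_trans[OF max_dev_ge[of n N \<mu> \<nu>] eps(2)]
    unfolding x_def p_def h_def dev_def by (auto simp: field_simps)
  have left: "x - a = \<mu> (n - 1) \<and> x - a \<in> ?S \<and> m < a \<and> a \<le> h \<and> a / 2 = m - dev \<mu> \<nu> (n - 1) \<and>
      \<bar>dev \<mu> \<nu> (n - 1)\<bar> \<le> \<epsilon>"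
    if "1 < n" "a = x - \<mu> (n - 1)" for a
  proof -
    have "1 \<le> n - 1" "n - 1 < N" "n - 1 + 1 = n" using n that by auto
    then show ?thesis
      using that(2) range(2)[of "n - 1"] max_gap_ge(3)[of "n - 1" N \<mu>] strict(2)[of "n - 1"]
        order_trans[OF max_dev_ge[of "n - 1" N \<mu> \<nu>] eps(2)]
      unfolding x_def m_def h_def dev_def by (auto simp: field_simps)
  qed
  consider "n = 1" | "n = N" "1 < n" | "1 < n" "n < N" using n by linarith
  then show ?thesis
  proof cases
    case 1
    define b where "b = \<mu> (n + 1) - x"
    have "n < N" using 1 N by simp
    note r = right[OF this b_def]
    show ?thesis
    proof (rule boundary[of b m])
      \<comment> \<open>Since \<open>D (\<nu> 0) = 0\<close>, it may be subtracted from
        \<open>D (\<nu> n)\<close>, which turns the one remaining flux into a difference quotient of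
        \<open>D\<close> times \<open>Q b\<close>.\<close>
      show "type_I_scheme D N \<mu> \<nu> f n = (D (\<nu> n) - D (\<nu> (n - 1))) / (\<nu> n - \<nu> (n - 1)) * Q b"
        using 1 N \<nu>0 D(2) unfolding type_I_scheme_def Q_def b_def x_def by simp
      show "D (x - m) = 0" using 1 \<nu>0 D(2) unfolding m_def by simp
      have "b / 2 = p + dev \<mu> \<nu> n" "\<bar>dev \<mu> \<nu> n\<bar> \<le> \<epsilon>" using r by blast+
      then show "\<bar>b / 2 - m\<bar> \<le> 3 * \<epsilon>" using pm by linarith
    qed (use r pos mh S 1 N in auto)
  next
    case 2
    define a where "a = x - \<mu> (n - 1)"
    note l = left[OF 2(2) a_def]
    show ?thesis
    proof (rule boundary[of "- a" "- p"])
      show "type_I_scheme D N \<mu> \<nu> f n = (D (\<nu> n) - D (\<nu> (n - 1))) / (\<nu> n - \<nu> (n - 1)) * Q (- a)"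
        using 2 \<nu>N D(3) unfolding type_I_scheme_def Q_minus a_def x_def by simp
      show "D (x - - p) = 0" using 2 \<nu>N D(3) unfolding p_def by simp
      have "a / 2 = m - dev \<mu> \<nu> (n - 1)" "\<bar>dev \<mu> \<nu> (n - 1)\<bar> \<le> \<epsilon>" using l by blast+
      then show "\<bar>- a / 2 - - p\<bar> \<le> 3 * \<epsilon>" using pm by linarith
    qed (use l pos ph S in auto)
  next
    case 3
    define a where "a = x - \<mu> (n - 1)"
    define b where "b = \<mu> (n + 1) - x"
    define \<delta> where "\<delta> = dev \<mu> \<nu> n - dev \<mu> \<nu> (n - 1)"
    note l = left[OF 3(1) a_def] and r = right[OF 3(2) b_def]
    have ab: "0 < a" "0 < b" using l r pos by auto
    have scheme: "type_I_scheme D N \<mu> \<nu> f n =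
        (D (\<nu> n) * Q b - D (\<nu> (n - 1)) * Q (- a)) / (\<nu> n - \<nu> (n - 1))"
      using 3 unfolding type_I_scheme_def Q_minus a_def b_def x_def
      by (simp add: Q_def x_def)
    have "\<bar>E 1 x * g 1 x + D x * g 2 x - (D (\<nu> n) * Q b - D (\<nu> (n - 1)) * Q (- a)) / (\<nu> n - \<nu> (n - 1))\<bar>
      \<le> 20 * K\<^sup>2 * \<epsilon>"
    proof (rule interior_error_algebra[OF K bounds(1) _ bounds(2,3) _ ab _ _ h eps(5) _ L])
      show "\<bar>D (\<nu> n)\<bar> \<le> K"
        using bounded_derivsD(2)[OF E S(2), of 0] D(1)[OF S(2)] unfolding p_def by simp
      show "\<bar>Q (- a)\<bar> \<le> K" "\<bar>Q (- a) - (g 1 x - g 2 x * a / 2)\<bar> \<le> K * \<epsilon>"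
        "\<bar>Q (- a) - (g 1 x - g 2 x * a / 2 + g 3 x * a\<^sup>2 / 6)\<bar> \<le> K * a ^ 3"
        using Q[of "- a"] l ab by auto
      show "\<bar>Q b - (g 1 x + g 2 x * b / 2 + g 3 x * b\<^sup>2 / 6)\<bar> \<le> K * b ^ 3"
        using Q[of b] r ab by auto
      show "\<bar>D (\<nu> n) - (D x + E 1 x * p)\<bar> \<le> K * \<epsilon>"
        using Dl[of p] S(2) pos ph unfolding p_def by simp
      have half: "a / 2 = m - dev \<mu> \<nu> (n - 1)" "\<bar>dev \<mu> \<nu> (n - 1)\<bar> \<le> \<epsilon>"
        "b / 2 = p + dev \<mu> \<nu> n" "\<bar>dev \<mu> \<nu> n\<bar> \<le> \<epsilon>" using l r by blast+
      then show "\<bar>p - a / 2\<bar> \<le> 3 * \<epsilon>" using pm by linarith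
      \<comment> \<open>\<open>b - a\<close> equals \<open>2 * (p - m)\<close> plus twice the sum of
        two deviations, hence at most 4 + 4 multiples of \<epsilon>.\<close>
      have "b - a = 2 * (b / 2) - 2 * (a / 2)" by simp
      then show "\<bar>b - a\<bar> \<le> 8 * \<epsilon>" using half pm by linarith
      have "a + b = 2 * (a / 2) + 2 * (b / 2)" by simp
      then show "a + b = 2 * ((\<nu> n - \<nu> (n - 1)) + \<delta>)"
        using half(1,3) unfolding \<delta>_def p_def m_def by argo
      \<comment> \<open>The difference of deviations has the opposite sign in
        \<open>beta\<close>.\<close>
      have "\<delta> * D (\<nu> n) / (\<nu> n - \<nu> (n - 1)) =
        - ((dev \<mu> \<nu> (n - 1) - dev \<mu> \<nu> n) * D (\<nu> n) / (\<nu> n - \<nu> (n - 1)))"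
        unfolding \<delta>_def by (simp add: left_diff_distrib diff_divide_distrib)
      then show "\<bar>\<delta> * D (\<nu> n) / (\<nu> n - \<nu> (n - 1))\<bar> \<le> \<epsilon>"
        using order_trans[OF beta_ge[of n N \<mu> \<nu> D] eps(4)] 3 by (simp del: times_divide_eq_left)
      show "0 < \<nu> n - \<nu> (n - 1)" using pos unfolding p_def m_def by simp
    qed (use l r in auto)
    then show ?thesis unfolding x_def[symmetric] FP scheme .
  qed
qed

section \<open>Passage to the limit\<close>

text \<open>The pointwise bound holds with a \<open>K\<close> independent of \<open>N\<close> as
  soon as \<open>\<epsilon> N \<le> 1\<close>, which is eventually true because
  \<open>\<epsilon>\<close> tends to 0.\<close>

lemma scheme_error_bigo:
  fixes \<mu> \<nu> :: "nat \<Rightarrow> nat \<Rightarrow> real"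
  assumes D: "Ck_on 3 D {-1..1}" "D (-1) = 0" "D 1 = 0" and f: "Ck_on 4 f {-1..1}"
    and grid: "\<And>N. N \<ge> 1 \<Longrightarrow> staggered_grid N (\<mu> N) (\<nu> N)"
    and gap: "(\<lambda>N. max_gap N (\<mu> N)) \<in> O(\<lambda>N. real N powr (-1))"
    and dev: "(\<lambda>N. max_dev N (\<mu> N) (\<nu> N)) \<in> O(\<lambda>N. real N powr (-2))"
    and dev_star: "(\<lambda>N. max_dev_star N (\<mu> N) (\<nu> N)) \<in> O(\<lambda>N. real N powr (-2))"
    and beta: "(\<lambda>N. beta D N (\<mu> N) (\<nu> N)) \<in> O(\<lambda>N. real N powr (-2))"
  shows "(\<lambda>N. scheme_error D N (\<mu> N) (\<nu> N) f) \<in> O(\<lambda>N. real N powr (-2))"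
proof -
  obtain E KD where E: "\<And>x. x \<in> {-1..1} \<Longrightarrow> D x = E 0 x" "bounded_derivs 3 E KD {-1..1}"
    using Ck_on_bounded_derivs[OF D(1)] by blast
  obtain g Kf where g: "\<And>x. x \<in> {-1..1} \<Longrightarrow> f x = g 0 x" "bounded_derivs 4 g Kf {-1..1}"
    using Ck_on_bounded_derivs[OF f] by blast
  define K where "K = max 1 (max KD Kf)"
  have K: "1 \<le> K" "bounded_derivs 3 E K {-1..1}" "bounded_derivs 4 g K {-1..1}"
    using bounded_derivs_mono[OF E(2), of K] bounded_derivs_mono[OF g(2), of K] unfolding K_def by auto
  \<comment> \<open>The summands are nonnegative, so the sum dominates each of the four quantities.
    Squaring the gap raises its rate to order 2.\<close>
  define \<epsilon> where "\<epsilon> N = (max_gap N (\<mu> N))\<^sup>2 + \<bar>max_dev N (\<mu> N) (\<nu> N)\<bar> + \<bar>max_dev_star N (\<mu> N) (\<nu> N)\<bar>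
    + \<bar>beta D N (\<mu> N) (\<nu> N)\<bar>" for N
  have "(real N powr (-1))\<^sup>2 = real N powr (-2)" for N
    unfolding power2_eq_square powr_add[symmetric] by simp
  then have "(\<lambda>N. (max_gap N (\<mu> N))\<^sup>2) \<in> O(\<lambda>N. real N powr (-2))"
    using landau_o.big_power[OF gap, of 2] by (simp only:)
  then have \<epsilon>: "\<epsilon> \<in> O(\<lambda>N. real N powr (-2))"
    unfolding \<epsilon>_def using dev dev_star beta by (intro sum_in_bigo) simp_all
  have "(\<lambda>N. real N powr (-2)) \<longlonglongrightarrow> 0"
    by (rule tendsto_neg_powr[OF _ filterlim_real_sequentially]) simp
  then have "(\<lambda>N. real N powr (-2)) \<in> o(\<lambda>_. 1)" by (intro smalloI_tendsto) simp_all
  then have "\<epsilon> \<in> o(\<lambda>_. 1)" using \<epsilon> landau_o.big_small_trans by blast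
  then have "\<epsilon> \<longlonglongrightarrow> 0" using smalloD_tendsto by fastforce
  then have small: "\<forall>\<^sub>F N in sequentially. \<epsilon> N < 1" by (rule order_tendstoD) simp
  have "\<forall>\<^sub>F N in sequentially. norm (scheme_error D N (\<mu> N) (\<nu> N) f) \<le> 20 * K\<^sup>2 * norm (\<epsilon> N)"
    using small eventually_ge_at_top[of 2]
  proof eventually_elim
    case (elim N)
    let ?e = "\<lambda>n. \<bar>Delta_FP D f (\<mu> N n) - type_I_scheme D N (\<mu> N) (\<nu> N) f n\<bar>"
    have pw: "?e n \<le> 20 * K\<^sup>2 * \<epsilon> N" if "n \<in> {1..N}" for n
    proof (rule pointwise_error_bound[OF grid _ _ _ K(2,3,1) E(1) D(2,3) g(1)])
      show "(max_gap N (\<mu> N))\<^sup>2 \<le> \<epsilon> N" "max_dev N (\<mu> N) (\<nu> N) \<le> \<epsilon> N"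
        "max_dev_star N (\<mu> N) (\<nu> N) \<le> \<epsilon> N" "beta D N (\<mu> N) (\<nu> N) \<le> \<epsilon> N"
        using zero_le_power2[of "max_gap N (\<mu> N)"] unfolding \<epsilon>_def by linarith+
    qed (use elim that in auto)
    \<comment> \<open>The maximum is attained, so the bound at a single node suffices.\<close>
    have "Max (?e ` {1..N}) \<in> ?e ` {1..N}" by (rule Max_in) (use elim in auto)
    then obtain n where n: "n \<in> {1..N}" "scheme_error D N (\<mu> N) (\<nu> N) f = ?e n"
      unfolding scheme_error_def by blast
    have "\<bar>scheme_error D N (\<mu> N) (\<nu> N) f\<bar> = ?e n" unfolding n(2) by simp
    also have "\<dots> \<le> 20 * K\<^sup>2 * \<epsilon> N" by (rule pw[OF n(1)])
    also have "\<dots> \<le> 20 * K\<^sup>2 * norm (\<epsilon> N)" by (intro mult_left_mono) auto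
    finally show ?case by simp
  qed
  then have "(\<lambda>N. scheme_error D N (\<mu> N) (\<nu> N) f) \<in> O(\<epsilon>)" by (rule bigoI)
  then show ?thesis using \<epsilon> by (rule landau_o.big_trans)
qed

section \<open>Reduction of the three sets of hypotheses to rates of order 2\<close>

lemma Ck_on_mono:
  assumes "Ck_on k f S" "j \<le> k"
  shows "Ck_on j f S"
proof -
  obtain g where "\<forall>x\<in>S. g 0 x = f x"
    "\<forall>i<k. \<forall>x\<in>S. (g i has_real_derivative g (Suc i) x) (at x within S)"
    "\<forall>i\<le>k. continuous_on S (g i)"
    using assms(1) unfolding Ck_on_def by blast
  then show ?thesis unfolding Ck_on_def using assms(2) by (intro exI[of _ g]) auto
qed

lemma bigo_powr_weaken:
  fixes p q :: real and u :: "nat \<Rightarrow> real"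
  assumes "u \<in> O(\<lambda>N. real N powr (-q))" "p \<le> q"
  shows "u \<in> O(\<lambda>N. real N powr (-p))"
proof -
  have "(\<lambda>N. real N powr (-q)) \<in> O(\<lambda>N. real N powr (-p))"
    by (rule bigoI[of _ 1], rule eventually_mono[OF eventually_ge_at_top[of 1]])
      (use assms(2) in \<open>auto intro!: powr_mono\<close>)
  with assms(1) show ?thesis by (rule landau_o.big_trans)
qed

theorem theorem2:
  fixes D :: "real \<Rightarrow> real"
    and \<mu> \<nu> :: "nat \<Rightarrow> nat \<Rightarrow> real"
    and q r s t :: real
  assumes "Ck_on 3 D {-1..1}" and "D (-1) = 0" and "D 1 = 0"
    and "\<forall>N\<ge>1. staggered_grid N (\<mu> N) (\<nu> N)"
    and "(\<lambda>N. max_gap N (\<mu> N)) \<in> O(\<lambda>N. real N powr (-1))"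
    and "(q \<ge> 2 \<and> (\<lambda>N. max_dev_star N (\<mu> N) (\<nu> N)) \<in> O(\<lambda>N. real N powr (-q)) \<and>
          r \<ge> 2 \<and> (\<lambda>N. max_dev N (\<mu> N) (\<nu> N)) \<in> O(\<lambda>N. real N powr (-r)) \<and>
          1 \<le> s \<and> s \<le> 4 * min q r - 2 \<and>
          (\<lambda>N. 1 / min_gap_star N (\<nu> N)) \<in> O(\<lambda>N. real N powr s) \<and>
          t \<ge> 2 \<and> (\<lambda>N. beta D N (\<mu> N) (\<nu> N)) \<in> O(\<lambda>N. real N powr (-t)))
       \<or> (\<forall>N\<ge>1. max_dev N (\<mu> N) (\<nu> N) = 0 \<and> max_dev_star N (\<mu> N) (\<nu> N) = 0)
       \<or> ((\<forall>N\<ge>1. \<forall>n\<in>{1..<N}. dev (\<mu> N) (\<nu> N) n = dev (\<mu> N) (\<nu> N) 1) \<and>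
          q \<ge> 2 \<and> (\<lambda>N. max_dev_star N (\<mu> N) (\<nu> N)) \<in> O(\<lambda>N. real N powr (-q)) \<and>
          r \<ge> 2 \<and> (\<lambda>N. max_dev N (\<mu> N) (\<nu> N)) \<in> O(\<lambda>N. real N powr (-r)) \<and>
          1 \<le> s \<and> s \<le> 4 * min q r - 2 \<and>
          (\<lambda>N. 1 / min_gap_star N (\<nu> N)) \<in> O(\<lambda>N. real N powr s))"
  shows "\<forall>f. Ck_on 5 f {-1..1} \<longrightarrow>
           (\<lambda>N. scheme_error D N (\<mu> N) (\<nu> N) f) \<in> O(\<lambda>N. real N powr (-2))"
proof -
  let ?O2 = "O(\<lambda>N. real N powr (-2))"
  have zero: "u \<in> ?O2" if "\<forall>N\<ge>1. u N = 0" for u :: "nat \<Rightarrow> real"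
    by (rule bigoI[of _ 0], rule eventually_mono[OF eventually_ge_at_top[of 1]]) (use that in auto)
  have beta0: "(\<lambda>N. beta D N (\<mu> N) (\<nu> N)) \<in> ?O2"
    if "\<forall>N\<ge>1. \<forall>n\<in>{1..<N}. dev (\<mu> N) (\<nu> N) n = dev (\<mu> N) (\<nu> N) 1"
  proof (intro zero allI impI)
    fix N :: nat assume "1 \<le> N"
    then have "\<forall>n\<in>{1..<N}. dev (\<mu> N) (\<nu> N) n = dev (\<mu> N) (\<nu> N) 1" using that by blast
    then show "beta D N (\<mu> N) (\<nu> N) = 0" by (rule beta_eq_0)
  qed
  \<comment> \<open>Conditions (1)-(6) and case (ii) share the rates of both deviations and differ
    only in the source of the bound on \<open>beta\<close>, so they form one case.\<close>
  consider
      "\<forall>N\<ge>1. max_dev N (\<mu> N) (\<nu> N) = 0 \<and> max_dev_star N (\<mu> N) (\<nu> N) = 0"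
    | "q \<ge> 2" "(\<lambda>N. max_dev_star N (\<mu> N) (\<nu> N)) \<in> O(\<lambda>N. real N powr (-q))"
      "r \<ge> 2" "(\<lambda>N. max_dev N (\<mu> N) (\<nu> N)) \<in> O(\<lambda>N. real N powr (-r))"
      "(t \<ge> 2 \<and> (\<lambda>N. beta D N (\<mu> N) (\<nu> N)) \<in> O(\<lambda>N. real N powr (-t))) \<or>
       (\<forall>N\<ge>1. \<forall>n\<in>{1..<N}. dev (\<mu> N) (\<nu> N) n = dev (\<mu> N) (\<nu> N) 1)"
    using assms(6) by argo
  then have "(\<lambda>N. max_dev N (\<mu> N) (\<nu> N)) \<in> ?O2 \<and> (\<lambda>N. max_dev_star N (\<mu> N) (\<nu> N)) \<in> ?O2 \<and>
      (\<lambda>N. beta D N (\<mu> N) (\<nu> N)) \<in> ?O2"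
  proof cases
    case 1
    \<comment> \<open>A zero maximum makes both deviations zero; index 1 is in range because
      \<open>n\<close> is.\<close>
    have "dev (\<mu> N) (\<nu> N) n = dev (\<mu> N) (\<nu> N) 1" if "N \<ge> 1" "n \<in> {1..<N}" for N n
      using max_dev_ge[of n N "\<mu> N" "\<nu> N"] max_dev_ge[of 1 N "\<mu> N" "\<nu> N"] that 1 by auto
    then have "(\<lambda>N. beta D N (\<mu> N) (\<nu> N)) \<in> ?O2" by (intro beta0) blast
    moreover have "(\<lambda>N. max_dev N (\<mu> N) (\<nu> N)) \<in> ?O2" by (rule zero) (use 1 in blast)
    moreover have "(\<lambda>N. max_dev_star N (\<mu> N) (\<nu> N)) \<in> ?O2" by (rule zero) (use 1 in blast)
    ultimately show ?thesis by blast
  next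
    case 2
    have "(\<lambda>N. beta D N (\<mu> N) (\<nu> N)) \<in> ?O2"
      using 2(5) by (elim disjE conjE; intro beta0 bigo_powr_weaken[of _ t 2]) assumption+
    then show ?thesis using bigo_powr_weaken[OF 2(2,1)] bigo_powr_weaken[OF 2(4,3)] by blast
  qed
  then have "(\<lambda>N. scheme_error D N (\<mu> N) (\<nu> N) f) \<in> ?O2" if "Ck_on 5 f {-1..1}" for f
  proof (intro scheme_error_bigo[OF assms(1-3) _ _ assms(5)])
    show "Ck_on 4 f {-1..1}" using that by (rule Ck_on_mono) simp
    show "staggered_grid N (\<mu> N) (\<nu> N)" if "N \<ge> 1" for N using assms(4) that by blast
  qed blast+
  then show ?thesis by blast
qed

end
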